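(* The Vámos matroid $V_8$ is freely representable over $\mathbb{Z}/8\mathbb{Z}$.
   Context: $V_8$ is the rank-4 matroid on $E=\{a,b,c,d,e,f,g,h\}$ whose circuits are the five 4-sets $\{a,b,c,d\},\{a,b,e,f\},\{c,d,e,f\},\{a,b,g,h\},\{c,d,g,h\}$ together with all 5-subsets of $E$ containing none of these. For the local ring $R=\mathbb{Z}/8\mathbb{Z}$ with maximal ideal $\mathfrak{m}=2R$, vectors $v_1,\dots,v_\ell$ are modular independent if $\sum\alpha_iv_i=0$ implies all $\alpha_i\in\mathfrak{m}$. For a $k\times|E|$ matrix $A$ over $R$, $M[A]$ is the independence system on the column index set whose independent sets are the sets of columns that are modular independent. A matroid $M$ is freely representable over $R$ if $M\cong M[A]$ for some matrix $A$ over $R$ which, after a permutation of columns, has the form $[I_k\mid P]$. *)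

theory Defs
  imports "Jordan_Normal_Form.Matrix" "HOL-Library.Numeral_Type"
    "HOL-Combinatorics.Permutations"
begin

section \<open>Independence systems and matroids\<close>

text \<open>A system is a pair consisting of a ground set and a family of independent sets.\<close>

type_synonym 'a indep_system = "'a set \<times> 'a set set"

definition matroid :: "'a indep_system \<Rightarrow> bool" where
  "matroid M \<longleftrightarrow> (case M of (E, I) \<Rightarrow>
     finite E \<and> I \<subseteq> Pow E \<and> {} \<in> I
     \<and> (\<forall>X Y. Y \<in> I \<longrightarrow> X \<subseteq> Y \<longrightarrow> X \<in> I)
     \<and> (\<forall>X Y. X \<in> I \<longrightarrow> Y \<in> I \<longrightarrow> card X < card Y \<longrightarrow> (\<exists>y \<in> Y - X. insert y X \<in> I)))"

definition circuits :: "'a indep_system \<Rightarrow> 'a set set" where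
  "circuits M = (case M of (E, I) \<Rightarrow> {C. C \<subseteq> E \<and> C \<notin> I \<and> (\<forall>X. X \<subset> C \<longrightarrow> X \<in> I)})"

definition rank :: "'a indep_system \<Rightarrow> nat" where
  "rank M = Max (card ` snd M)"

definition isomorphic :: "'a indep_system \<Rightarrow> 'b indep_system \<Rightarrow> bool" where
  "isomorphic M N \<longleftrightarrow> (\<exists>\<phi>. bij_betw \<phi> (fst M) (fst N)
     \<and> (\<forall>X. X \<subseteq> fst M \<longrightarrow> (X \<in> snd M \<longleftrightarrow> \<phi> ` X \<in> snd N)))"


section \<open>Free representability over the integers modulo 8\<close>

text \<open>The numeral type \<^typ>\<open>8\<close> is the ring of integers modulo 8.\<close>

definition max_ideal_Z8 :: "8 set" where
  "max_ideal_Z8 = {2 * r | r. True}"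

text \<open>The vectors form a family indexed by \<open>J\<close>, so repeated vectors are counted separately.\<close>

definition modular_independent :: "nat \<Rightarrow> ('i \<Rightarrow> 8 vec) \<Rightarrow> 'i set \<Rightarrow> bool" where
  "modular_independent k v J \<longleftrightarrow>
     (\<forall>\<alpha> :: 'i \<Rightarrow> 8. finsum_vec TYPE(8) k (\<lambda>j. \<alpha> j \<cdot>\<^sub>v v j) J = 0\<^sub>v k
        \<longrightarrow> (\<forall>j\<in>J. \<alpha> j \<in> max_ideal_Z8))"

definition column_system :: "8 mat \<Rightarrow> nat indep_system" where
  "column_system A = ({..<dim_col A},
     {J. J \<subseteq> {..<dim_col A} \<and> modular_independent (dim_row A) (col A) J})"

definition append_cols :: "'a :: zero mat \<Rightarrow> 'a mat \<Rightarrow> 'a mat" where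
  "append_cols A B = four_block_mat A B (0\<^sub>m 0 (dim_col A)) (0\<^sub>m 0 (dim_col B))"

definition permute_cols :: "(nat \<Rightarrow> nat) \<Rightarrow> 'a mat \<Rightarrow> 'a mat" where
  "permute_cols \<pi> A = mat (dim_row A) (dim_col A) (\<lambda>(i, j). A $$ (i, \<pi> j))"

definition identity_block_form :: "8 mat \<Rightarrow> bool" where
  "identity_block_form A \<longleftrightarrow> (\<exists>\<pi> P. \<pi> permutes {..<dim_col A} \<and> dim_row P = dim_row A
     \<and> permute_cols \<pi> A = append_cols (1\<^sub>m (dim_row A)) P)"

definition freely_representable_Z8 :: "'a indep_system \<Rightarrow> bool" where
  "freely_representable_Z8 M \<longleftrightarrow>
     matroid M \<and> (\<exists>A. identity_block_form A \<and> isomorphic M (column_system A))"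


section \<open>The Vamos matroid\<close>

datatype vamos_elem = Va | Vb | Vc | Vd | Ve | Vf | Vg | Vh

definition V8_ground :: "vamos_elem set" where
  "V8_ground = {Va, Vb, Vc, Vd, Ve, Vf, Vg, Vh}"

definition V8_small_circuits :: "vamos_elem set set" where
  "V8_small_circuits =
     {{Va, Vb, Vc, Vd}, {Va, Vb, Ve, Vf}, {Vc, Vd, Ve, Vf}, {Va, Vb, Vg, Vh}, {Vc, Vd, Vg, Vh}}"

definition V8_circuits :: "vamos_elem set set" where
  "V8_circuits = V8_small_circuits \<union>
     {C. C \<subseteq> V8_ground \<and> card C = 5 \<and> (\<forall>D \<in> V8_small_circuits. \<not> D \<subseteq> C)}"

text \<open>The matroid is determined by its circuits; \<open>circuits_V8\<close>, \<open>rank_V8\<close> and \<open>matroid_V8\<close>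
  below confirm that this is the intended one.\<close>

definition V8 :: "vamos_elem indep_system" where
  "V8 = (V8_ground, {X. X \<subseteq> V8_ground \<and> (\<forall>C \<in> V8_circuits. \<not> C \<subseteq> X)})"

lemma V8_ground_UNIV: "V8_ground = UNIV"
  unfolding V8_ground_def by (auto intro: vamos_elem.exhaust)

lemma finite_vamos [simp]: "finite (X :: vamos_elem set)"
proof -
  have "finite V8_ground" by (simp add: V8_ground_def)
  then show ?thesis by (metis V8_ground_UNIV finite_subset subset_UNIV)
qed

lemma card_V8_small: "D \<in> V8_small_circuits \<Longrightarrow> card D = 4"
  unfolding V8_small_circuits_def by auto

lemma V8_small_inter:
  "C \<in> V8_small_circuits \<Longrightarrow> D \<in> V8_small_circuits \<Longrightarrow> C \<noteq> D \<Longrightarrow> card (C \<inter> D) \<le> 2"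
  unfolding V8_small_circuits_def by (elim insertE emptyE) simp_all

lemma V8_indep_iff: "X \<in> snd V8 \<longleftrightarrow> card X \<le> 4 \<and> X \<notin> V8_small_circuits"
proof
  assume X: "X \<in> snd V8"
  then have no: "\<And>C. C \<in> V8_circuits \<Longrightarrow> \<not> C \<subseteq> X" by (auto simp: V8_def)
  have "card X \<le> 4"
  proof (rule ccontr)
    assume "\<not> card X \<le> 4"
    then have "5 \<le> card X" by simp
    then obtain C where C: "C \<subseteq> X" "card C = 5"
      by (rule obtain_subset_with_card_n)
    have "\<forall>D \<in> V8_small_circuits. \<not> D \<subseteq> C" using no C(1) by (auto simp: V8_circuits_def)
    then have "C \<in> V8_circuits" using C by (simp add: V8_circuits_def V8_ground_UNIV)
    with no C show False by blast
  qed
  moreover have "X \<notin> V8_small_circuits" using no by (auto simp: V8_circuits_def)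
  ultimately show "card X \<le> 4 \<and> X \<notin> V8_small_circuits" ..
next
  assume X: "card X \<le> 4 \<and> X \<notin> V8_small_circuits"
  have "\<not> C \<subseteq> X" if C: "C \<in> V8_circuits" for C
  proof
    assume sub: "C \<subseteq> X"
    then have "card C \<le> 4" using X card_mono[OF finite_vamos sub] by simp
    then have small: "C \<in> V8_small_circuits" using C by (auto simp: V8_circuits_def)
    then have "C = X" using card_V8_small X sub by (metis card_seteq finite_vamos)
    with small X show False by simp
  qed
  then show "X \<in> snd V8" by (simp add: V8_def V8_ground_UNIV)
qed

lemma matroid_V8: "matroid V8"
proof -
  have down: "X \<in> snd V8" if Y: "Y \<in> snd V8" and "X \<subseteq> Y" for X Y
  proof -
    have "card X \<le> card Y" using that by (simp add: card_mono)
    then show ?thesis using that card_V8_small[of X] card_seteq[of Y X]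
      by (fastforce simp: V8_indep_iff)
  qed
  have aug: "\<exists>y \<in> Y - X. insert y X \<in> snd V8"
    if X: "X \<in> snd V8" and Y: "Y \<in> snd V8" and lt: "card X < card Y" for X Y
  proof (rule ccontr)
    assume neg: "\<not> ?thesis"
    have Y4: "card Y \<le> 4" using Y by (simp add: V8_indep_iff)
    have ins: "insert y X \<in> V8_small_circuits" if "y \<in> Y - X" for y
      using neg that Y4 lt by (auto simp: V8_indep_iff card_insert_if)
    obtain y where y: "y \<in> Y - X"
      using lt by (metis Diff_eq_empty_iff all_not_in_conv card_mono finite_vamos not_le)
    have cX: "card X = 3" using card_V8_small[OF ins[OF y]] y by simp
    have "Y \<noteq> insert y X" using ins[OF y] Y by (auto simp: V8_indep_iff)
    moreover have "card Y = card (insert y X)" using cX y Y4 lt by simp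
    ultimately have "\<not> Y \<subseteq> insert y X" by (metis card_subset_eq finite_vamos)
    then obtain z where z: "z \<in> Y - X" "z \<noteq> y" by blast
    have "insert y X \<inter> insert z X = X" "insert y X \<noteq> insert z X" using y z by auto
    with V8_small_inter[OF ins[OF y] ins[OF z(1)]] cX show False by simp
  qed
  have "{} \<in> snd V8" using card_V8_small[of "{}"] by (auto simp: V8_indep_iff)
  moreover have "V8 = (UNIV, snd V8)" by (simp add: V8_def V8_ground_UNIV)
  ultimately have "matroid (UNIV, snd V8)"
    unfolding matroid_def case_prod_conv using down aug
    by (intro conjI allI impI) (simp_all only: finite_vamos Pow_UNIV subset_UNIV)
  then show ?thesis using \<open>V8 = (UNIV, snd V8)\<close> by (rule back_subst[of matroid, OF _ sym])
qed

lemma rank_V8: "rank V8 = 4"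
proof -
  have "{Va, Vb, Vc, Ve} \<in> snd V8" unfolding V8_indep_iff V8_small_circuits_def by auto
  moreover have "card {Va, Vb, Vc, Ve} = 4" by simp
  ultimately have "4 \<in> card ` snd V8" by (metis imageI)
  moreover have "finite (snd V8)"
    by (rule finite_subset[of _ "Pow UNIV"]) (simp, simp only: finite_Pow_iff finite_vamos)
  ultimately show ?thesis unfolding rank_def
    by (intro Max_eqI) (auto simp: V8_indep_iff)
qed

lemma V8_dep_iff: "X \<notin> snd V8 \<longleftrightarrow> (\<exists>C \<in> V8_circuits. C \<subseteq> X)"
  by (simp add: V8_def V8_ground_UNIV)

lemma circuits_V8_iff:
  "C \<in> circuits V8 \<longleftrightarrow> C \<notin> snd V8 \<and> (\<forall>X. X \<subset> C \<longrightarrow> X \<in> snd V8)"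
  by (simp only: circuits_def case_prod_beta V8_ground_UNIV mem_Collect_eq)
    (simp add: V8_def V8_ground_UNIV)

lemma circuits_V8: "circuits V8 = V8_circuits"
proof (rule subset_antisym; rule subsetI)
  fix C assume C: "C \<in> circuits V8"
  then obtain D where D: "D \<in> V8_circuits" "D \<subseteq> C"
    by (metis circuits_V8_iff V8_dep_iff)
  then have "D \<notin> snd V8" by (metis V8_dep_iff subset_refl)
  with C D have "D = C" by (metis circuits_V8_iff psubsetI)
  with D show "C \<in> V8_circuits" by simp
next
  fix C assume C: "C \<in> V8_circuits"
  then have nin: "C \<notin> snd V8" by (metis V8_dep_iff subset_refl)
  have "X \<in> snd V8" if X: "X \<subset> C" for X
  proof -
    have lt: "card X < card C" using X by (simp add: psubset_card_mono)
    from C consider "C \<in> V8_small_circuits"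
      | "card C = 5" "\<forall>D \<in> V8_small_circuits. \<not> D \<subseteq> C"
      by (auto simp: V8_circuits_def)
    then show ?thesis
    proof cases
      case 1
      then have "card X < 4" using lt card_V8_small by simp
      moreover from this have "X \<notin> V8_small_circuits" using card_V8_small[of X] by linarith
      ultimately show ?thesis by (simp add: V8_indep_iff)
    next
      case 2
      then have "X \<notin> V8_small_circuits" using X by blast
      with 2 lt show ?thesis by (simp add: V8_indep_iff)
    qed
  qed
  with nin show "C \<in> circuits V8" by (simp add: circuits_V8_iff)
qed

end

theory Submission
  imports Defs "Jordan_Normal_Form.Determinant"
begin

text \<open>
  Lift a matrix over \<open>\<int>/8\<close> to the integers. A set of columns is modular dependent iff it supports
  an integer vector with an odd entry that the matrix annihilates modulo 8. More columns than rows
  are always dependent: an integer kernel vector divided by the gcd of its entries has an odd entry.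
  For the matrix \<open>[I | P]\<close> below, found by computer search, the kernel modulo 8 is parametrised by
  the four coordinates of \<open>P\<close>, and an inspection of its \<open>8 ^ 4\<close> elements shows that those with an
  odd entry and at most four nonzero entries are supported exactly on the 4-element circuits of \<open>V8\<close>.
\<close>

section \<open>Modular independence expressed through integer lifts\<close>

lemma of_int_Z8_eq_0_iff: "(of_int z :: 8) = 0 \<longleftrightarrow> 8 dvd z"
  by (simp add: of_int_eq_0_iff_char_dvd)

text \<open>Two lifts of the same residue differ by a multiple of 8, an even number, so parity does
  not depend on the lift.\<close>

lemma of_int_Z8_in_max_ideal_iff: "of_int z \<in> max_ideal_Z8 \<longleftrightarrow> even z"
proof
  assume "of_int z \<in> max_ideal_Z8"
  then obtain r :: 8 where r: "of_int z = 2 * r"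
    by (auto simp: max_ideal_Z8_def)
  obtain w where "r = of_int w"
    by (cases r) auto
  with r have "(of_int (z - 2 * w) :: 8) = 0"
    by simp
  then have "8 dvd z - 2 * w"
    by (simp only: of_int_Z8_eq_0_iff)
  then show "even z"
    by presburger
next
  assume "even z"
  then obtain w where "z = 2 * w" ..
  then have "of_int z = 2 * (of_int w :: 8)"
    by simp
  then show "of_int z \<in> max_ideal_Z8"
    unfolding max_ideal_Z8_def by blast
qed

lemma finsum_col_eq_0_iff:
  fixes A :: "8 mat"
  assumes J: "J \<subseteq> {..<dim_col A}"
  shows "finsum_vec TYPE(8) (dim_row A) (\<lambda>j. \<alpha> j \<cdot>\<^sub>v col A j) J = 0\<^sub>v (dim_row A) \<longleftrightarrow>
    (\<forall>i<dim_row A. (\<Sum>j\<in>J. A $$ (i, j) * \<alpha> j) = 0)"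
proof -
  have fin: "finite J"
    using J finite_subset by blast
  have car: "(\<lambda>j. \<alpha> j \<cdot>\<^sub>v col A j) \<in> J \<rightarrow> carrier_vec (dim_row A)"
    by auto
  have "finsum_vec TYPE(8) (dim_row A) (\<lambda>j. \<alpha> j \<cdot>\<^sub>v col A j) J $ i = (\<Sum>j\<in>J. A $$ (i, j) * \<alpha> j)"
    if "i < dim_row A" for i
    unfolding index_finsum_vec[OF fin that car]
    using J that by (intro sum.cong) (auto simp: mult.commute)
  then show ?thesis
    using finsum_vec_closed[OF car] by (auto intro!: eq_vecI)
qed

text \<open>Every element of the ring is the image of an integer, so coefficient families over
  \<open>8\<close> may be replaced by integer families.\<close>

lemma modular_independent_of_int_iff:
  fixes B :: "int mat"
  assumes J: "J \<subseteq> {..<dim_col B}"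
  shows "modular_independent (dim_row B) (col (map_mat of_int B)) J \<longleftrightarrow>
    (\<forall>z. (\<forall>i<dim_row B. 8 dvd (\<Sum>j\<in>J. B $$ (i, j) * z j)) \<longrightarrow> (\<forall>j\<in>J. even (z j)))"
proof -
  let ?A = "map_mat of_int B :: 8 mat"
  have sum: "(\<Sum>j\<in>J. ?A $$ (i, j) * of_int (z j)) = of_int (\<Sum>j\<in>J. B $$ (i, j) * z j)"
    if "i < dim_row B" for i z
    unfolding of_int_sum using J that by (intro sum.cong) auto
  have lift: "\<exists>z. \<alpha> = (\<lambda>j. of_int (z j))" for \<alpha> :: "nat \<Rightarrow> 8"
  proof -
    have "\<forall>j. \<exists>z. \<alpha> j = of_int z"
      by (meson bit0_cases)
    then show ?thesis
      by (auto dest!: choice)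
  qed
  have all: "(\<forall>\<alpha> :: nat \<Rightarrow> 8. P \<alpha>) \<longleftrightarrow> (\<forall>z. P (\<lambda>j. of_int (z j)))" for P
    using lift by metis
  show ?thesis
    unfolding modular_independent_def
    using finsum_col_eq_0_iff[of J ?A] J
    by (subst all) (simp add: sum of_int_Z8_eq_0_iff of_int_Z8_in_max_ideal_iff
        del: of_int_sum index_map_mat(1))
qed

section \<open>Dependence of more columns than rows\<close>

text \<open>Padding with zero rows gives a square matrix of determinant 0, and over an integral
  domain such a matrix kills a nonzero vector with entries in that domain.\<close>

lemma exists_int_kernel_vector:
  fixes c :: "nat \<Rightarrow> 'b \<Rightarrow> int"
  assumes fin: "finite J" and card: "k < card J"
  shows "\<exists>z. (\<forall>i<k. (\<Sum>j\<in>J. c i j * z j) = 0) \<and> (\<exists>j\<in>J. z j \<noteq> 0)"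
proof -
  let ?n = "card J"
  obtain e where e: "bij_betw e {0..<?n} J"
    using ex_bij_betw_nat_finite[OF fin] by blast
  define M where "M = mat ?n ?n (\<lambda>(i, j). if i < k then c i (e j) else 0)"
  have M: "M \<in> carrier_mat ?n ?n"
    by (simp add: M_def)
  \<comment> \<open>Row \<open>k\<close> of \<open>M\<close> is already a padding row, since
    \<open>k < ?n\<close>; this puts \<open>M\<close> into the shape that \<open>det_row_0\<close>
    expects.\<close>
  have rows: "mat\<^sub>r ?n ?n (\<lambda>i. if i = k then 0\<^sub>v ?n else row M i) = M"
    by (rule eq_matI) (auto simp: M_def)
  have "row M \<in> {0..<?n} \<rightarrow> carrier_vec ?n"
    by (auto simp: M_def)
  then have "det M = 0"
    using det_row_0[OF card, of "row M"] by (simp only: rows)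
  then obtain v where v: "v \<in> carrier_vec ?n" "v \<noteq> 0\<^sub>v ?n" "M *\<^sub>v v = 0\<^sub>v ?n"
    using det_0_iff_vec_prod_zero[OF M] by blast
  define z where "z = (\<lambda>j. v $ the_inv_into {0..<?n} e j)"
  have z: "z (e j) = v $ j" if "j < ?n" for j
    using that e by (simp add: z_def the_inv_into_f_f bij_betw_def)
  have "(\<Sum>j\<in>J. c i j * z j) = 0" if "i < k" for i
  proof -
    have "(\<Sum>j\<in>J. c i j * z j) = (\<Sum>j = 0..<?n. c i (e j) * z (e j))"
      by (rule sum.reindex_bij_betw[OF e, symmetric])
    also have "\<dots> = (M *\<^sub>v v) $ i"
      using that card v(1) by (simp add: M_def scalar_prod_def z)
    finally show ?thesis
      using v(3) that card by simp
  qed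
  moreover have "\<exists>j\<in>J. z j \<noteq> 0"
  proof -
    obtain j where "j < ?n" "v $ j \<noteq> 0"
      using v(1,2) by (metis eq_vecI carrier_vecD index_zero_vec)
    then show ?thesis
      using z e by (metis atLeastLessThan_iff bij_betwE zero_le)
  qed
  ultimately show ?thesis by blast
qed

lemma exists_odd_int_kernel_vector:
  fixes c :: "nat \<Rightarrow> 'b \<Rightarrow> int"
  assumes "finite J" and "k < card J"
  shows "\<exists>z. (\<forall>i<k. (\<Sum>j\<in>J. c i j * z j) = 0) \<and> (\<exists>j\<in>J. odd (z j))"
proof -
  obtain z where z: "\<And>i. i < k \<Longrightarrow> (\<Sum>j\<in>J. c i j * z j) = 0" and nz: "\<exists>j\<in>J. z j \<noteq> 0"
    using exists_int_kernel_vector[OF assms, of c] by blast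
  define g where "g = Gcd (z ` J)"
  define y where "y = (\<lambda>j. z j div g)"
  have g: "g \<noteq> 0"
    using nz by (auto simp: g_def)
  have zy: "z j = g * y j" if "j \<in> J" for j
    using that by (simp add: y_def g_def)
  have "(\<Sum>j\<in>J. c i j * y j) = 0" if "i < k" for i
  proof -
    have "g * (\<Sum>j\<in>J. c i j * y j) = (\<Sum>j\<in>J. c i j * z j)"
      unfolding sum_distrib_left by (intro sum.cong) (auto simp: zy)
    then show ?thesis
      using z[OF that] g by simp
  qed
  moreover have "\<exists>j\<in>J. odd (y j)"
  proof (rule ccontr)
    assume "\<not> ?thesis"
    then have "g * 2 dvd z j" if "j \<in> J" for j
      using that zy by auto
    then have "g * 2 dvd Gcd (z ` J)"
      by (intro Gcd_greatest) blast
    \<comment> \<open>If all quotients were even, twice the gcd would divide every entry and hence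
      the gcd itself.\<close>
    then have "g * 2 dvd g"
      by (simp only: g_def)
    with g show False by simp
  qed
  ultimately show ?thesis by blast
qed

section \<open>The representing matrix and its kernel modulo 8\<close>

text \<open>The columns represent \<open>a, b, c, e, d, f, g, h\<close>, in this order: the first four form a basis of
  \<open>V8\<close>, whereas \<open>a, b, c, d\<close> is a circuit.\<close>

definition vamos_mat :: "int mat" where
  "vamos_mat = mat_of_rows_list 8
     [[1, 0, 0, 0, 1, 1, - 1, 4],
      [0, 1, 0, 0, 1, 1, - 2, - 1],
      [0, 0, 1, 0, 1, 0, 1, 1],
      [0, 0, 0, 1, 0, 1, 2, 2]]"

text \<open>The five 4-element circuits of \<open>V8\<close> in column numbers, with
  \<open>d\<close> in column 4 and \<open>e\<close> in column 3.\<close>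

definition vamos_small :: "nat set set" where
  "vamos_small = {{0, 1, 2, 4}, {0, 1, 3, 5}, {2, 3, 4, 5}, {0, 1, 6, 7}, {2, 4, 6, 7}}"

lemma card_vamos_small: "S \<in> vamos_small \<Longrightarrow> card S = 4"
  unfolding vamos_small_def by (elim insertE emptyE) simp_all

lemma dim_vamos_mat [simp]: "dim_row vamos_mat = 4" "dim_col vamos_mat = 8"
  by (simp_all add: vamos_mat_def mat_of_rows_list_def)

lemma lessThan_4: "{..<4::nat} = {0, 1, 2, 3}"
  by auto

lemma lessThan_8: "{..<8::nat} = {0, 1, 2, 3, 4, 5, 6, 7}"
  by auto

lemma all_less_4: "(\<forall>i<4::nat. P i) \<longleftrightarrow> P 0 \<and> P 1 \<and> P 2 \<and> P 3"
  using lessThan_4 by (metis insert_iff lessThan_iff empty_iff)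

lemma vamos_mat_index:
  "i < 4 \<Longrightarrow> j < 8 \<Longrightarrow> vamos_mat $$ (i, j) =
    [[1, 0, 0, 0, 1, 1, - 1, 4],
     [0, 1, 0, 0, 1, 1, - 2, - 1],
     [0, 0, 1, 0, 1, 0, 1, 1],
     [0, 0, 0, 1, 0, 1, 2, 2]] ! i ! j"
  by (simp add: vamos_mat_def mat_of_rows_list_def)

text \<open>The members of \<open>vamos_small\<close> as indicator lists, in the same order.\<close>

abbreviation vamos_patterns :: "bool list list" where
  "vamos_patterns \<equiv>
     [[True, True, True, False, True, False, False, False],
      [True, True, False, True, False, True, False, False],
      [False, False, True, True, True, True, False, False],
      [True, True, False, False, False, False, True, True],
      [False, False, True, False, True, False, True, True]]"

text \<open>The variables are the free coordinates, in columns 4 to 7; the first four entries of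
  \<open>x\<close> are the identity coordinates that the rows of the matrix then force.\<close>

lemma kernel_supports:
  "\<forall>d\<in>set [0..7]. \<forall>f\<in>set [0..7]. \<forall>g\<in>set [0..7]. \<forall>h\<in>set [0..7::int].
    (let x = map (\<lambda>t. t mod 8)
       [g - d - f - 4 * h, 2 * g + h - d - f, - d - g - h, - f - 2 * g - 2 * h, d, f, g, h];
      s = map (\<lambda>t. t \<noteq> 0) x in
     (\<forall>t\<in>set x. t mod 2 = 0) \<or> 4 < length (filter id s) \<or>
     s \<in> set vamos_patterns)"
  by code_simp

lemma vamos_kernel_support:
  fixes x :: "nat \<Rightarrow> int"
  \<comment> \<open>Canonical representatives make nonzero as an integer the same as nonzero modulo
    8.\<close>
  assumes range: "\<And>j. x j \<in> {0..7}"
    and ker: "\<And>i. i < 4 \<Longrightarrow> 8 dvd (\<Sum>j<8. vamos_mat $$ (i, j) * x j)"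
    and odd: "j < 8" "odd (x j)"
  shows "4 < card {j. j < 8 \<and> x j \<noteq> 0} \<or> {j. j < 8 \<and> x j \<noteq> 0} \<in> vamos_small"
proof -
  let ?S = "{j. j < 8 \<and> x j \<noteq> 0}"
  have x: "x j \<in> set [0..7]" for j
    using range[of j] by simp
  have xmod: "x j mod 8 = x j" for j
    using range[of j] by simp
  have upt: "[0..<8] = [0, 1, 2, 3, 4, 5, 6, 7::nat]"
    by (simp add: upt_rec)
  have solve: "x j = t mod 8" if "8 dvd x j - t" for j t
    using that xmod[of j] by (metis mod_eq_dvd_iff)
  \<comment> \<open>Each row contains exactly one identity coordinate, with coefficient 1, and is
    solved for it.\<close>
  have eqs: "x 0 = (x 6 - x 4 - x 5 - 4 * x 7) mod 8" "x 1 = (2 * x 6 + x 7 - x 4 - x 5) mod 8"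
    "x 2 = (- x 4 - x 6 - x 7) mod 8" "x 3 = (- x 5 - 2 * x 6 - 2 * x 7) mod 8"
    using ker[of 0] ker[of 1] ker[of 2] ker[of 3]
    by (auto intro!: solve simp: lessThan_8 vamos_mat_index algebra_simps)
  have list: "map x [0..<8] = map (\<lambda>t. t mod 8) [x 6 - x 4 - x 5 - 4 * x 7,
      2 * x 6 + x 7 - x 4 - x 5, - x 4 - x 6 - x 7, - x 5 - 2 * x 6 - 2 * x 7, x 4, x 5, x 6, x 7]"
    unfolding upt list.map eqs[symmetric] xmod by simp
  define s where "s = map (\<lambda>t. t \<noteq> 0) (map x [0..<8])"
  have alt: "(\<forall>t\<in>set (map x [0..<8]). t mod 2 = 0) \<or> 4 < length (filter id s) \<or>
     s \<in> set vamos_patterns"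
    using kernel_supports[THEN bspec, OF x[of 4], THEN bspec, OF x[of 5], THEN bspec,
        OF x[of 6], THEN bspec, OF x[of 7]]
    unfolding s_def list Let_def .
  have not_even: "\<not> (\<forall>t\<in>set (map x [0..<8]). t mod 2 = 0)"
    using odd by (auto simp: odd_iff_mod_2_eq_one)
  \<comment> \<open>In this form the support is computed by simplification for each concrete pattern
    \<open>s\<close>.\<close>
  have S: "?S = set (filter ((!) s) [0..<8])"
    by (auto simp: s_def simp del: map_map)
  have card: "length (filter id s) = card ?S"
  proof -
    have "length (filter id s) = length (filter (\<lambda>j. x j \<noteq> 0) [0..<8])"
      by (simp add: s_def filter_map o_def)
    also have "\<dots> = card (set (filter (\<lambda>j. x j \<noteq> 0) [0..<8]))"
      by (intro distinct_card[symmetric]) simp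
    also have "set (filter (\<lambda>j. x j \<noteq> 0) [0..<8]) = ?S"
      by auto
    finally show ?thesis .
  qed
  have "set (filter ((!) s) [0..<8]) \<in> vamos_small" if "s \<in> set vamos_patterns" for s
    using that unfolding upt vamos_small_def
    by (simp only: list.set insert_iff empty_iff) (elim disjE; simp)
  then have "?S \<in> vamos_small" if "s \<in> set vamos_patterns"
    unfolding S using that .
  with alt not_even show ?thesis
    unfolding card by blast
qed

lemma vamos_small_kernel:
  assumes "J \<in> vamos_small"
  shows "\<exists>z. (\<forall>i<4. 8 dvd (\<Sum>j\<in>J. vamos_mat $$ (i, j) * z j)) \<and> (\<exists>j\<in>J. odd (z j))"
proof -
  consider "J = {0, 1, 2, 4}" | "J = {0, 1, 3, 5}" | "J = {2, 3, 4, 5}" | "J = {0, 1, 6, 7}"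
    | "J = {2, 4, 6, 7}"
    using assms unfolding vamos_small_def insert_iff empty_iff by argo
  then show ?thesis
  proof cases
    case 1
    then show ?thesis
      \<comment> \<open>The witness lists are indexed by column number; zeros stand at the columns
        outside \<open>J\<close>.\<close>
      by (intro exI[of _ "(!) [- 1, - 1, - 1, 0, 1]"]) (simp add: all_less_4 vamos_mat_index)
  next
    case 2
    then show ?thesis
      by (intro exI[of _ "(!) [- 1, - 1, 0, - 1, 0, 1]"]) (simp add: all_less_4 vamos_mat_index)
  next
    case 3
    then show ?thesis
      by (intro exI[of _ "(!) [0, 0, - 1, 1, 1, - 1]"]) (simp add: all_less_4 vamos_mat_index)
  next
    case 4
    then show ?thesis
      by (intro exI[of _ "(!) [5, 1, 0, 0, 0, 0, 1, - 1]"]) (simp add: all_less_4 vamos_mat_index)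
  next
    case 5
    then show ?thesis
      \<comment> \<open>Unlike the four relations above, which hold over the integers, this one
        holds only modulo 8: the row sums are 16, 0, 8 and 8.\<close>
      by (intro exI[of _ "(!) [0, 0, - 1, 0, 5, 0, 1, 3]"]) (simp add: all_less_4 vamos_mat_index)
  qed
qed

section \<open>The modular independent sets of columns\<close>

lemma vamos_mat_modular_independent_iff:
  assumes J: "J \<subseteq> {..<8}"
  shows "modular_independent 4 (col (map_mat of_int vamos_mat)) J \<longleftrightarrow> card J \<le> 4 \<and> J \<notin> vamos_small"
    (is "?ind \<longleftrightarrow> _")
proof -
  have fin: "finite J"
    using J finite_subset by blast
  have ind: "?ind \<longleftrightarrow> (\<forall>z. (\<forall>i<4. 8 dvd (\<Sum>j\<in>J. vamos_mat $$ (i, j) * z j)) \<longrightarrow> (\<forall>j\<in>J. even (z j)))"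
    using modular_independent_of_int_iff[of J vamos_mat] J by simp
  show ?thesis
  proof
    assume ?ind
    then have "card J \<le> 4"
      using exists_odd_int_kernel_vector[OF fin, of 4 "\<lambda>i j. vamos_mat $$ (i, j)"]
      unfolding ind by (metis dvd_0_right not_le)
    moreover have "J \<notin> vamos_small"
      using \<open>?ind\<close> vamos_small_kernel[of J] unfolding ind by blast
    ultimately show "card J \<le> 4 \<and> J \<notin> vamos_small" ..
  next
    assume J4: "card J \<le> 4 \<and> J \<notin> vamos_small"
    show ?ind
      unfolding ind
    proof (intro allI impI ballI, rule ccontr)
      fix z j
      assume ker: "\<forall>i<4. 8 dvd (\<Sum>j\<in>J. vamos_mat $$ (i, j) * z j)" and j: "j \<in> J" "odd (z j)"
      \<comment> \<open>Extending by zero and reducing modulo 8 preserves the row congruences and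
        parities and meets the range condition of \<open>vamos_kernel_support\<close>.\<close>
      define x where "x = (\<lambda>j. if j \<in> J then z j mod 8 else 0)"
      let ?S = "{j. j < 8 \<and> x j \<noteq> 0}"
      have "8 dvd (\<Sum>j<8. vamos_mat $$ (i, j) * x j)" if "i < 4" for i
      proof -
        have "(\<Sum>j<8. vamos_mat $$ (i, j) * x j) = (\<Sum>j\<in>J. vamos_mat $$ (i, j) * (z j mod 8))"
          using J by (intro sum.mono_neutral_cong_right) (auto simp: x_def)
        also have "\<dots> mod 8 = (\<Sum>j\<in>J. vamos_mat $$ (i, j) * z j) mod 8"
          by (subst (1 2) mod_sum_eq[symmetric]) (simp add: mod_mult_right_eq)
        finally show ?thesis
          using ker that by (simp add: dvd_eq_mod_eq_0)
      qed
      moreover have "odd (x j)"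
        using j by (simp add: x_def dvd_mod_iff)
      moreover have "x j \<in> {0..7}" for j
        using pos_mod_bound[of 8 "z j"] by (auto simp: x_def)
      ultimately have S: "4 < card ?S \<or> ?S \<in> vamos_small"
        using vamos_kernel_support[of x j] j J by blast
      have sub: "?S \<subseteq> J"
        by (auto simp: x_def split: if_splits)
      then have "card ?S \<le> card J"
        using fin by (rule card_mono[rotated])
      with S J4 have small: "?S \<in> vamos_small"
        by linarith
      then have "card ?S = 4"
        by (rule card_vamos_small)
      \<comment> \<open>The support has 4 elements and lies in \<open>J\<close>, which has at most
        4, so it fills \<open>J\<close>.\<close>
      with J4 have "?S = J"
        using card_seteq[OF fin sub] by simp
      with small J4 show False by simp
    qed
  qed
qed

section \<open>The isomorphism with \<open>V8\<close> and the block form\<close>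

fun vamos_column :: "vamos_elem \<Rightarrow> nat" where
  "vamos_column Va = 0"
| "vamos_column Vb = 1"
| "vamos_column Vc = 2"
| "vamos_column Vd = 4"
| "vamos_column Ve = 3"
| "vamos_column Vf = 5"
| "vamos_column Vg = 6"
| "vamos_column Vh = 7"

lemma inj_vamos_column: "inj vamos_column"
proof (rule injI)
  fix u v assume "vamos_column u = vamos_column v"
  then show "u = v" by (cases u; cases v) simp_all
qed

lemma range_vamos_column: "range vamos_column = {..<8}"
  unfolding lessThan_8 V8_ground_UNIV[symmetric] V8_ground_def by auto

lemma vamos_small_eq: "vamos_small = (`) vamos_column ` V8_small_circuits"
  unfolding vamos_small_def V8_small_circuits_def by (simp add: insert_commute)

text \<open>On both sides independence means at most 4 elements and not one of five listed sets, so
  a bijection matching these sets suffices.\<close>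

lemma isomorphic_V8_vamos_mat: "isomorphic V8 (column_system (map_mat of_int vamos_mat))"
  unfolding isomorphic_def
proof (intro exI conjI allI impI)
  have V8: "fst V8 = UNIV"
    by (simp add: V8_def V8_ground_UNIV)
  show "bij_betw vamos_column (fst V8) (fst (column_system (map_mat of_int vamos_mat)))"
    unfolding V8 using inj_vamos_column range_vamos_column
    by (simp add: column_system_def bij_betw_def)
  fix X
  have sub: "vamos_column ` X \<subseteq> {..<8}"
    using range_vamos_column by blast
  have "X \<in> V8_small_circuits \<longleftrightarrow> vamos_column ` X \<in> vamos_small"
    unfolding vamos_small_eq using inj_vamos_column
    by (simp add: inj_image_mem_iff inj_on_image_Pow inj_image_eq_iff inj_on_def)
  moreover have "card (vamos_column ` X) = card X"
    using inj_vamos_column by (simp add: card_image inj_on_subset)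
  ultimately show "X \<in> snd V8 \<longleftrightarrow> vamos_column ` X \<in> snd (column_system (map_mat of_int vamos_mat))"
    using sub vamos_mat_modular_independent_iff[OF sub]
    by (simp add: V8_indep_iff column_system_def)
qed

lemma identity_block_form_vamos_mat: "identity_block_form (map_mat of_int vamos_mat)"
  unfolding identity_block_form_def
proof (intro exI conjI)
  let ?A = "map_mat of_int vamos_mat :: 8 mat"
  let ?P = "mat 4 4 (\<lambda>(i, j). ?A $$ (i, j + 4))"
  \<comment> \<open>The basis \<open>a, b, c, e\<close> already occupies the first four columns, so
    the identity permutation serves.\<close>
  show "id permutes {..<dim_col ?A}"
    by (rule permutes_id)
  show "dim_row ?P = dim_row ?A"
    by simp
  have "vamos_mat $$ (i, j) = (if i = j then 1 else 0)" if "i < 4" "j < 4" for i j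
  proof -
    have "i \<in> {0, 1, 2, 3}" "j \<in> {0, 1, 2, 3}"
      using that lessThan_4 by blast+
    then show ?thesis
      by (auto simp: vamos_mat_index)
  qed
  then show "permute_cols id ?A = append_cols (1\<^sub>m (dim_row ?A)) ?P"
    by (intro eq_matI) (simp_all add: permute_cols_def append_cols_def)
qed

theorem theorem5p9:
  shows "freely_representable_Z8 V8"
  unfolding freely_representable_Z8_def
  using matroid_V8 identity_block_form_vamos_mat isomorphic_V8_vamos_mat by blast

end
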